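(* Let $n$ be a positive even integer, let $Q$ be a finite subset of $\mathbb{R}^n$ with at least two points, and let $X=F(\mathbb{R}^n-Q,2)$. Then $\mathrm{GC}(X)\le 5$.
   Context: $F(\mathbb{R}^n-Q,2)$ denotes the space of ordered pairs of distinct points of $\mathbb{R}^n-Q$, with the metric induced from the Euclidean metric on $\mathbb{R}^n\times\mathbb{R}^n$. Let $I=[0,1]$. For a topological space $Z$, $P(Z)=Z^I$ is the space of continuous maps $I\to Z$ with the compact-open topology, and $P(Z;z_0,z_1)$ is the subspace of paths from $z_0$ to $z_1$. The length of a path in a metric space is the supremum of the sums of distances between successive points on the path. A (minimal) geodesic from $x_0$ to $x_1$ in a metric space $(Z,d)$ is a path $\gamma$ from $x_0$ to $x_1$ with $d(\gamma(t),\gamma(t'))=|t-t'|\,d(x_0,x_1)$ for all $t,t'\in I$. A metric space is geodesic if every pair of its points is joined by a geodesic. Let $X$ be a metric space whose completion $\overline{X}$ is geodesic. For $x_0,x_1\in X$, a near-geodesic from $x_0$ to $x_1$ is a continuous map $\phi:I\to P(\overline{X};x_0,x_1)$ such that (i) $\phi(0)$ is a geodesic in $\overline{X}$ from $x_0$ to $x_1$; (ii) $\phi((0,1])\subset P(X;x_0,x_1)$; (iii) if $s_n\to 0$, then $\operatorname{length}(\phi(s_n))\to\operatorname{length}(\phi(0))$. For $E\subset X\times X$, a near-geodesic motion planning rule (NGMPR) on $E$ is a continuous map $\Phi:E\to P(\overline{X})^I$ such that, for all $(x_0,x_1)\in E$, $\Phi(x_0,x_1)$ is a near-geodesic from $x_0$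 to $x_1$, with the additional proviso that $\Phi(x_0,x_1)(0)$ is a geodesic in $X$ if a geodesic in $X$ from $x_0$ to $x_1$ exists. The geodesic complexity $\mathrm{GC}(X)$ is the smallest $k$ such that $X\times X$ can be partitioned into locally compact sets $E_0,\ldots,E_k$ such that each $E_i$ has an NGMPR. *)

theory Defs
  imports "HOL-Analysis.Analysis"
begin

definition config2 :: "'a set \<Rightarrow> ('a \<times> 'a) set" where
  "config2 Y = {(a, b). a \<in> Y \<and> b \<in> Y \<and> a \<noteq> b}"


text \<open>A map from a space \<open>A\<close> is represented by its extension that is \<open>undefined\<close> outside
  \<open>topspace A\<close>, so that equality of functions is equality of maps. The subbasic set for
  the empty compact set is the set of all continuous maps.\<close>

definition compact_open_topology :: "'a topology \<Rightarrow> 'b topology \<Rightarrow> ('a \<Rightarrow> 'b) topology" where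
  "compact_open_topology A B = topology_generated_by
     {{f \<in> extensional (topspace A). continuous_map A B f \<and> f ` K \<subseteq> U} | K U.
        compactin A K \<and> openin B U}"

lemma topspace_compact_open_topology:
  "topspace (compact_open_topology A B) =
     {f \<in> extensional (topspace A). continuous_map A B f}" (is "_ = ?C")
proof
  show "topspace (compact_open_topology A B) \<subseteq> ?C"
    by (auto simp: compact_open_topology_def)
  show "?C \<subseteq> topspace (compact_open_topology A B)"
  proof
    fix f assume f: "f \<in> ?C"
    have "?C \<in> {{f \<in> extensional (topspace A). continuous_map A B f \<and> f ` K \<subseteq> U} | K U.
        compactin A K \<and> openin B U}"
      by (rule CollectI, rule exI[of _ "{}"], rule exI[of _ "{}"]) auto
    with f show "f \<in> topspace (compact_open_topology A B)"
      unfolding compact_open_topology_def topology_generated_by_topspace by blast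
  qed
qed

definition path_space :: "'a topology \<Rightarrow> (real \<Rightarrow> 'a) topology" where
  "path_space Z = compact_open_topology (top_of_set {0..1}) Z"

definition paths_between :: "'a::topological_space set \<Rightarrow> 'a \<Rightarrow> 'a \<Rightarrow> (real \<Rightarrow> 'a) set" where
  "paths_between Z x0 x1 =
     {\<gamma> \<in> topspace (path_space (top_of_set Z)). \<gamma> 0 = x0 \<and> \<gamma> 1 = x1}"

definition curve_length :: "(real \<Rightarrow> 'a::metric_space) \<Rightarrow> ennreal" where
  "curve_length \<gamma> =
     (SUP (m, t) \<in> {(m::nat, t::nat \<Rightarrow> real). mono_on {..m} t \<and> t ` {..m} \<subseteq> {0..1}}.
        ennreal (\<Sum>i<m. dist (\<gamma> (t i)) (\<gamma> (t (Suc i)))))"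

definition is_geodesic :: "'a::metric_space set \<Rightarrow> 'a \<Rightarrow> 'a \<Rightarrow> (real \<Rightarrow> 'a) \<Rightarrow> bool" where
  "is_geodesic Z x0 x1 \<gamma> \<longleftrightarrow>
     \<gamma> \<in> paths_between Z x0 x1 \<and>
     (\<forall>t\<in>{0..1}. \<forall>t'\<in>{0..1}. dist (\<gamma> t) (\<gamma> t') = \<bar>t - t'\<bar> * dist x0 x1)"

definition geodesic_space :: "'a::metric_space set \<Rightarrow> bool" where
  "geodesic_space Z \<longleftrightarrow> (\<forall>x0\<in>Z. \<forall>x1\<in>Z. \<exists>\<gamma>. is_geodesic Z x0 x1 \<gamma>)"


text \<open>From here on \<open>X\<close> is a subset of a complete metric space, so that its completion is
  \<open>closure X\<close>. The notions below are meant for \<open>X\<close> with \<open>geodesic_space (closure X)\<close>.\<close>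

definition near_geodesic ::
    "'a::complete_space set \<Rightarrow> 'a \<Rightarrow> 'a \<Rightarrow> (real \<Rightarrow> real \<Rightarrow> 'a) \<Rightarrow> bool" where
  "near_geodesic X x0 x1 \<phi> \<longleftrightarrow>
     continuous_map (top_of_set {0..1})
       (subtopology (path_space (top_of_set (closure X))) (paths_between (closure X) x0 x1)) \<phi> \<and>
     is_geodesic (closure X) x0 x1 (\<phi> 0) \<and>
     (\<forall>s\<in>{0<..1}. \<phi> s \<in> paths_between X x0 x1) \<and>
     (\<forall>s. (\<forall>n. s n \<in> {0..1}) \<and> s \<longlonglongrightarrow> 0 \<longrightarrow>
        (\<lambda>n. curve_length (\<phi> (s n))) \<longlonglongrightarrow> curve_length (\<phi> 0))"

definition NGMPR ::
    "'a::complete_space set \<Rightarrow> ('a \<times> 'a) set \<Rightarrow> ('a \<times> 'a \<Rightarrow> real \<Rightarrow> real \<Rightarrow> 'a) \<Rightarrow> bool" where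
  "NGMPR X E \<Phi> \<longleftrightarrow>
     continuous_map (top_of_set E) (path_space (path_space (top_of_set (closure X)))) \<Phi> \<and>
     (\<forall>(x0, x1)\<in>E. near_geodesic X x0 x1 (\<Phi> (x0, x1)) \<and>
        ((\<exists>\<gamma>. is_geodesic X x0 x1 \<gamma>) \<longrightarrow> is_geodesic X x0 x1 (\<Phi> (x0, x1) 0)))"

text \<open>The value is \<open>\<infinity>\<close> if there is no such partition. Members of a partition may be
  empty, which does not affect the minimum.\<close>

definition geodesic_complexity :: "'a::complete_space set \<Rightarrow> enat" where
  "geodesic_complexity X =
     Inf {enat k | k. \<exists>E :: nat \<Rightarrow> ('a \<times> 'a) set.
        (\<Union>i\<le>k. E i) = X \<times> X \<and> disjoint_family_on E {..k} \<and>
        (\<forall>i\<le>k. locally compact (E i) \<and> (\<exists>\<Phi>. NGMPR X (E i) \<Phi>))}"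


text \<open>The completion of the configuration space in question is geodesic.\<close>

lemma closure_config2:
  fixes Q :: "'a::euclidean_space set"
  assumes "finite Q"
  shows "closure (config2 (UNIV - Q)) = UNIV"
proof -
  let ?A = "(- Q) \<times> (- Q)" and ?D = "{p :: 'a \<times> 'a. fst p = snd p}"
  have "interior Q = {}"
    using assms by (simp add: empty_interior_finite)
  then have A: "closure ?A = UNIV"
    by (simp add: closure_Times closure_complement)
  have oA: "open ?A"
    using assms by (intro open_Times) (auto simp: finite_imp_closed open_Compl)
  have D: "closure (- ?D) = UNIV"
  proof -
    have "subspace ?D"
      by (auto simp: subspace_def)
    moreover have "?D \<noteq> UNIV"
    proof -
      obtain b :: 'a where "b \<in> Basis" using nonempty_Basis by blast
      then have "(b, 0) \<notin> ?D" using nonzero_Basis by auto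
      then show ?thesis by blast
    qed
    ultimately have "dim ?D < dim (UNIV :: ('a \<times> 'a) set)"
      by (metis dim_eq_full dim_subset_UNIV dim_UNIV le_neq_implies_less span_eq_iff)
    then have "interior ?D = {}"
      by (intro empty_interior_lowdim) (simp add: dim_UNIV)
    then show ?thesis by (simp add: closure_complement)
  qed
  have "?A \<subseteq> closure (?A \<inter> - ?D)"
    using open_Int_closure_subset[OF oA, of "- ?D"] D by auto
  then have "UNIV \<subseteq> closure (?A \<inter> - ?D)"
    using A closure_minimal[of ?A "closure (?A \<inter> - ?D)"] by auto
  moreover have "config2 (UNIV - Q) = ?A \<inter> - ?D"
    by (auto simp: config2_def)
  ultimately show ?thesis by auto
qed

lemma geodesic_space_closure_config2:
  fixes Q :: "'a::euclidean_space set"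
  assumes "finite Q"
  shows "geodesic_space (closure (config2 (UNIV - Q)))"
proof -
  have "is_geodesic UNIV x y (restrict (linepath x y) {0..1})" for x y :: "'a \<times> 'a"
  proof -
    have "continuous_on {0..1} (restrict (linepath x y) {0..1})"
      using continuous_on_linepath continuous_on_eq[of "{0..1}" "linepath x y"] by fastforce
    moreover have "dist (linepath x y t) (linepath x y t') = \<bar>t - t'\<bar> * dist x y" for t t'
    proof -
      have "linepath x y t - linepath x y t' = (t' - t) *\<^sub>R (x - y)"
        by (simp add: linepath_def algebra_simps)
      then show ?thesis by (simp add: dist_norm abs_minus_commute)
    qed
    ultimately show ?thesis
      by (simp add: is_geodesic_def paths_between_def path_space_def
          topspace_compact_open_topology linepath_0' linepath_1')
  qed
  then show ?thesis
    unfolding geodesic_space_def closure_config2[OF assms] by blast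
qed

end

theory Submission
  imports Defs
begin

text \<open>
  The completion of the configuration space is \<open>\<real>\<^sup>n \<times> \<real>\<^sup>n\<close>, where the unique geodesic from
  \<open>(a, b)\<close> to \<open>(a', b')\<close> is the straight path. It leaves the configuration space exactly when
  the segment from \<open>a\<close> to \<open>a'\<close> or the one from \<open>b\<close> to \<open>b'\<close> meets \<open>Q\<close>, or when the two points
  collide, that is, when the segment from \<open>b - a\<close> to \<open>b' - a'\<close> meets \<open>{0}\<close>. So three
  segments have to be pushed off finite sets, none of which contains an endpoint.

  As \<open>n\<close> is even, there is a linear map \<open>J\<close> with \<open>J v\<close> nonzero and perpendicular to \<open>v\<close> for all
  \<open>v \<noteq> 0\<close>. Adding \<open>\<mu> t (1 - t) J v\<close> to a straight path with direction \<open>v\<close> moves all its interior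
  points off its line, hence away from the obstacles on the segment; when \<open>\<mu>\<close> is small compared
  with the distance to the other obstacles, those are avoided too (\<open>sideways_avoids\<close>). By
  linearity of \<open>J\<close>, the same bump in both coordinates induces the bump of this form in their
  difference, so that one formula, \<open>detour\<close>, takes care of all three segments at once. Its
  length tends to that of the straight path because the bump is Lipschitz with a constant
  proportional to the parameter.

  The admissible size of \<open>\<mu>\<close> depends continuously on the endpoints as long as the set of
  obstacles that are hit is locally constant. Each of these sets is upper semicontinuous.
  Where the number of points hit, truncated at 2, is constant, it is even locally constant
  (\<open>eventually_obstacles_eq\<close>): two points that remain on a segment determine its line, and on
  a fixed line the obstacles met cannot change, as no endpoint is an obstacle. Stratify by
  the sum of the three truncated counts. It is upper semicontinuous, so its level sets are
  locally compact; and within a level set near a given point none of the three counts can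
  drop, as none can rise. The counts are at most 2, 2 and 1, which gives the six level sets
  for the values \<open>0, \<dots>, 5\<close>.
\<close>


section \<open>Currying into the compact-open topology\<close>

text \<open>The half of the exponential law that holds for all spaces: if \<open>{a} \<times> K\<close> is mapped
  into an open set, then, by compactness of \<open>K\<close>, so is a tube \<open>S \<times> K\<close> around it.\<close>

lemma continuous_map_curry_compact_open:
  assumes f: "continuous_map (prod_topology A B) C f"
  shows "continuous_map A (compact_open_topology B C)
           (\<lambda>a. restrict (\<lambda>b. f (a, b)) (topspace B))"
proof -
  let ?g = "\<lambda>a. restrict (\<lambda>b. f (a, b)) (topspace B)"
  let ?S = "{{f \<in> extensional (topspace B). continuous_map B C f \<and> f ` K \<subseteq> U} | K U.
        compactin B K \<and> openin C U}"
  have cont: "continuous_map B C (?g a)" if "a \<in> topspace A" for a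
  proof -
    have "continuous_map B (prod_topology A B) (\<lambda>b. (a, b))"
      using that by (simp add: continuous_map_pairedI)
    from continuous_map_compose[OF this f] show ?thesis
      by (rule continuous_map_eq) simp
  qed
  show ?thesis
    unfolding compact_open_topology_def
  proof (rule continuous_on_generated_topo)
    fix U assume "U \<in> ?S"
    then obtain K V where U: "U = {f \<in> extensional (topspace B). continuous_map B C f \<and> f ` K \<subseteq> V}"
      and K: "compactin B K" and V: "openin C V"
      by blast
    have KB: "K \<subseteq> topspace B"
      using K by (rule compactin_subset_topspace)
    have W: "openin (prod_topology A B) {z \<in> topspace (prod_topology A B). f z \<in> V}"
      using f V by (rule openin_continuous_map_preimage)
    show "openin A (?g -` U \<inter> topspace A)"
    proof (subst openin_subopen, intro ballI)
      fix a assume a: "a \<in> ?g -` U \<inter> topspace A"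
      then have "?g a ` K \<subseteq> V"
        by (auto simp: U)
      then have sub: "{a} \<times> K \<subseteq> {z \<in> topspace (prod_topology A B). f z \<in> V}"
        using a KB by auto
      have "compactin A {a}"
        using a finite_imp_compactin[of "{a}" A] by blast
      then obtain S T where ST: "openin A S" "openin B T" "{a} \<subseteq> S" "K \<subseteq> T"
          "S \<times> T \<subseteq> {z \<in> topspace (prod_topology A B). f z \<in> V}"
        by (rule Wallace_theorem_prod_topology[OF _ K W sub])
      have "S \<subseteq> ?g -` U \<inter> topspace A"
      proof
        fix a' assume a': "a' \<in> S"
        then have "a' \<in> topspace A"
          using ST(1) openin_subset by blast
        moreover have "?g a' ` K \<subseteq> V"
          using ST a' KB by auto
        ultimately show "a' \<in> ?g -` U \<inter> topspace A"
          using cont by (simp add: U)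
      qed
      with ST show "\<exists>T. openin A T \<and> a \<in> T \<and> T \<subseteq> ?g -` U \<inter> topspace A"
        by blast
    qed
  next
    show "?g ` topspace A \<subseteq> \<Union> ?S"
    proof clarify
      fix a assume "a \<in> topspace A"
      then have "?g a \<in> {f \<in> extensional (topspace B). continuous_map B C f \<and> f ` {} \<subseteq> {}}"
        using cont by simp
      moreover have "{f \<in> extensional (topspace B). continuous_map B C f \<and> f ` {} \<subseteq> {}} \<in> ?S"
        using compactin_empty openin_empty by blast
      ultimately show "?g a \<in> \<Union> ?S"
        by blast
    qed
  qed
qed

text \<open>A motion planning rule takes its values in a path space of a path space, so joint
  continuity in endpoints, parameter and time is curried twice.\<close>

lemma continuous_map_curry_path_space:
  fixes H :: "'a::topological_space \<Rightarrow> real \<Rightarrow> real \<Rightarrow> 'b::topological_space"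
  assumes "continuous_on ((E \<times> {0..1}) \<times> {0..1}) (\<lambda>((x, s), t). H x s t)"
  shows "continuous_map (top_of_set E) (path_space (path_space euclidean))
           (\<lambda>x. restrict (\<lambda>s. restrict (H x s) {0..1}) {0..1})"
proof -
  have "continuous_map (prod_topology (prod_topology (top_of_set E) (top_of_set {0..1}))
          (top_of_set {0..1})) euclidean (\<lambda>((x, s), t). H x s t)"
    using assms by simp
  from continuous_map_curry_compact_open[OF this]
  have "continuous_map (prod_topology (top_of_set E) (top_of_set {0..1})) (path_space euclidean)
          (\<lambda>z. restrict (H (fst z) (snd z)) {0..1})"
    unfolding path_space_def topspace_euclidean_subtopology case_prod_unfold fst_conv snd_conv .
  from continuous_map_curry_compact_open[OF this] show ?thesis
    unfolding path_space_def topspace_euclidean_subtopology fst_conv snd_conv .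
qed


section \<open>Length of Lipschitz curves\<close>

lemma curve_length_le_Lipschitz:
  assumes L: "\<And>t t'. t \<in> {0..1} \<Longrightarrow> t' \<in> {0..1} \<Longrightarrow> dist (\<gamma> t) (\<gamma> t') \<le> L * \<bar>t - t'\<bar>"
  shows "curve_length \<gamma> \<le> ennreal L"
  unfolding curve_length_def
proof (rule SUP_least, clarify)
  fix m and t :: "nat \<Rightarrow> real"
  assume mono: "mono_on {..m} t" and t: "t ` {..m} \<subseteq> {0..1}"
  have "dist (\<gamma> 0) (\<gamma> 1) \<le> L"
    using L[of 0 1] by simp
  then have "0 \<le> L"
    by (rule order_trans[OF zero_le_dist])
  have "(\<Sum>i<m. dist (\<gamma> (t i)) (\<gamma> (t (Suc i)))) \<le> (\<Sum>i<m. L * (t (Suc i) - t i))"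
  proof (rule sum_mono)
    fix i assume "i \<in> {..<m}"
    then have "t i \<in> {0..1}" "t (Suc i) \<in> {0..1}" "t i \<le> t (Suc i)"
      using t mono by (auto simp: image_subset_iff intro: mono_onD)
    then show "dist (\<gamma> (t i)) (\<gamma> (t (Suc i))) \<le> L * (t (Suc i) - t i)"
      using L[of "t i" "t (Suc i)"] by simp
  qed
  also have "\<dots> = L * (t m - t 0)"
    by (simp add: sum_distrib_left[symmetric] sum_lessThan_telescope)
  also have "\<dots> \<le> L"
  proof -
    have "t m \<in> {0..1}" "t 0 \<in> {0..1}"
      using t by auto
    then show ?thesis
      using \<open>0 \<le> L\<close> by (intro mult_left_le) auto
  qed
  finally show "ennreal (\<Sum>i<m. dist (\<gamma> (t i)) (\<gamma> (t (Suc i)))) \<le> ennreal L"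
    by (rule ennreal_leI)
qed

lemma dist_endpoints_le_curve_length: "ennreal (dist (\<gamma> 0) (\<gamma> 1)) \<le> curve_length \<gamma>"
proof -
  have "(1, real) \<in> {(m::nat, t::nat \<Rightarrow> real). mono_on {..m} t \<and> t ` {..m} \<subseteq> {0..1}}"
    by (auto simp: mono_on_def)
  from SUP_upper[OF this, of "\<lambda>(m, t). ennreal (\<Sum>i<m. dist (\<gamma> (t i)) (\<gamma> (t (Suc i))))"]
  show ?thesis
    by (simp add: curve_length_def)
qed


section \<open>Obstacles on a segment\<close>

definition obstacles :: "'a::euclidean_space set \<Rightarrow> 'a \<Rightarrow> 'a \<Rightarrow> 'a set" where
  "obstacles Q p q = Q \<inter> closed_segment p q"

text \<open>Counting stops at 2 because two obstacles already determine the line that contains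
  the segment.\<close>

definition crossing_rank :: "'a::euclidean_space set \<Rightarrow> 'a \<Rightarrow> 'a \<Rightarrow> nat" where
  "crossing_rank Q p q = min 2 (card (obstacles Q p q))"

text \<open>A positive lower bound for the distances to the obstacles off the segment. A product is
  used because it is continuous in the endpoints wherever its index set is constant.\<close>

definition clearance :: "'a::euclidean_space set \<Rightarrow> 'a \<Rightarrow> 'a \<Rightarrow> real" where
  "clearance Q p q = (\<Prod>r\<in>Q - obstacles Q p q. min 1 (infdist r (closed_segment p q)))"

text \<open>Moving the endpoints of a segment moves a point with fixed barycentric coordinates
  by at most the sum of the two displacements.\<close>

lemma infdist_closed_segment_perturb:
  fixes r :: "'a::euclidean_space"
  shows "infdist r (closed_segment p' q') \<le> infdist r (closed_segment p q) + dist p p' + dist q q'"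
proof -
  obtain x where x: "x \<in> closed_segment p q" "infdist r (closed_segment p q) = dist r x"
    using infdist_attains_inf[of "closed_segment p q" r] by auto
  then obtain u where u: "0 \<le> u" "u \<le> 1" "x = (1 - u) *\<^sub>R p + u *\<^sub>R q"
    by (auto simp: in_segment)
  let ?y = "(1 - u) *\<^sub>R p' + u *\<^sub>R q'"
  have "?y \<in> closed_segment p' q'"
    using u by (auto simp: in_segment)
  then have "infdist r (closed_segment p' q') \<le> dist r ?y"
    by (rule infdist_le)
  also have "\<dots> \<le> dist r x + dist x ?y"
    by (rule dist_triangle)
  also have "dist x ?y \<le> dist p p' + dist q q'"
  proof -
    have "x - ?y = (1 - u) *\<^sub>R (p - p') + u *\<^sub>R (q - q')"
      using u by (simp add: algebra_simps)
    then have "dist x ?y \<le> (1 - u) * dist p p' + u * dist q q'"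
      using u norm_triangle_ineq[of "(1 - u) *\<^sub>R (p - p')" "u *\<^sub>R (q - q')"]
      by (simp add: dist_norm)
    also have "\<dots> \<le> 1 * dist p p' + 1 * dist q q'"
      using u by (intro add_mono mult_right_mono) auto
    finally show ?thesis by simp
  qed
  finally show ?thesis
    using x by simp
qed

lemma tendsto_infdist_closed_segment:
  fixes r :: "'a::euclidean_space"
  assumes "(f \<longlongrightarrow> p) F" "(g \<longlongrightarrow> q) F"
  shows "((\<lambda>y. infdist r (closed_segment (f y) (g y))) \<longlongrightarrow> infdist r (closed_segment p q)) F"
proof (rule tendsto_dist_iff[THEN iffD2], rule tendsto_sandwich[OF _ _ tendsto_const])
  show "\<forall>\<^sub>F y in F. 0 \<le> dist (infdist r (closed_segment (f y) (g y))) (infdist r (closed_segment p q))"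
    by simp
  show "\<forall>\<^sub>F y in F. dist (infdist r (closed_segment (f y) (g y))) (infdist r (closed_segment p q))
          \<le> dist (f y) p + dist (g y) q"
  proof (rule always_eventually, rule allI)
    fix y
    show "dist (infdist r (closed_segment (f y) (g y))) (infdist r (closed_segment p q))
          \<le> dist (f y) p + dist (g y) q"
      using infdist_closed_segment_perturb[of r p q "f y" "g y"]
        infdist_closed_segment_perturb[of r "f y" "g y" p q]
      by (simp add: dist_real_def dist_commute abs_le_iff)
  qed
  show "((\<lambda>y. dist (f y) p + dist (g y) q) \<longlongrightarrow> 0) F"
    using tendsto_add[OF assms[THEN tendsto_dist_iff[THEN iffD1]]] by simp
qed

lemma infdist_closed_segment_pos_iff:
  fixes r :: "'a::euclidean_space"
  shows "0 < infdist r (closed_segment p q) \<longleftrightarrow> r \<notin> closed_segment p q"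
  using in_closed_iff_infdist_zero[of "closed_segment p q" r] infdist_nonneg[of r "closed_segment p q"]
  by (auto simp: less_le)

lemma clearance_pos: "0 < clearance Q p q"
  unfolding clearance_def
  by (rule prod_pos) (auto simp: obstacles_def infdist_closed_segment_pos_iff)

lemma clearance_le:
  assumes "finite Q" "r \<in> Q" "r \<notin> closed_segment p q"
  shows "clearance Q p q \<le> infdist r (closed_segment p q)"
proof -
  let ?f = "\<lambda>r. min 1 (infdist r (closed_segment p q))"
  have r: "r \<in> Q - obstacles Q p q"
    using assms by (auto simp: obstacles_def)
  have "clearance Q p q = ?f r * (\<Prod>r\<in>Q - obstacles Q p q - {r}. ?f r)"
    unfolding clearance_def using assms r by (intro prod.remove) auto
  also have "\<dots> \<le> ?f r * 1"
    by (intro mult_left_mono prod_le_1) (auto simp: infdist_nonneg)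
  finally show ?thesis by simp
qed

lemma clearance_le_1: "clearance Q p q \<le> 1"
  unfolding clearance_def by (rule prod_le_1) (auto simp: infdist_nonneg)

lemma eventually_obstacles_subset:
  assumes "finite Q" "(f \<longlongrightarrow> p) F" "(g \<longlongrightarrow> q) F"
  shows "\<forall>\<^sub>F y in F. obstacles Q (f y) (g y) \<subseteq> obstacles Q p q"
proof -
  have "\<forall>\<^sub>F y in F. 0 < infdist r (closed_segment (f y) (g y))" if "r \<in> Q - obstacles Q p q" for r
    using that
    by (intro order_tendstoD(1)[OF tendsto_infdist_closed_segment[OF assms(2,3)]])
      (auto simp: infdist_closed_segment_pos_iff obstacles_def)
  then have "\<forall>\<^sub>F y in F. \<forall>r\<in>Q - obstacles Q p q. 0 < infdist r (closed_segment (f y) (g y))"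
    using assms(1) by (intro eventually_ball_finite) auto
  then show ?thesis
    by eventually_elim (auto simp: infdist_closed_segment_pos_iff obstacles_def)
qed

lemma eventually_crossing_rank_le:
  assumes "finite Q" "(f \<longlongrightarrow> p) F" "(g \<longlongrightarrow> q) F"
  shows "\<forall>\<^sub>F y in F. crossing_rank Q (f y) (g y) \<le> crossing_rank Q p q"
  using eventually_obstacles_subset[OF assms]
proof eventually_elim
  case (elim y)
  moreover have "finite (obstacles Q p q)"
    using assms(1) by (simp add: obstacles_def)
  ultimately have "card (obstacles Q (f y) (g y)) \<le> card (obstacles Q p q)"
    by (rule card_mono[rotated])
  then show ?case
    by (auto simp: crossing_rank_def)
qed

text \<open>The common points \<open>u\<close> and \<open>v\<close> force both segments to lie on one line, hence \<open>r\<close> lies on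
  the line through \<open>p'\<close> and \<open>q'\<close>; the sign of the inner product says that it lies between them.
  This open condition on \<open>p'\<close> and \<open>q'\<close> is what survives small perturbations.\<close>

lemma in_closed_segment_transfer:
  fixes p q p' q' :: "'a::euclidean_space"
  assumes "u \<noteq> v" "u \<in> closed_segment p q" "v \<in> closed_segment p q" "r \<in> closed_segment p q"
    and "u \<in> closed_segment p' q'" "v \<in> closed_segment p' q'"
    and neg: "(p' - r) \<bullet> (q' - r) < 0"
  shows "r \<in> closed_segment p' q'"
proof -
  have par: "\<exists>c. x = a + c *\<^sub>R (b - a)" if "x \<in> closed_segment a b" for x a b :: 'a
    using that by (auto simp: in_segment algebra_simps)
  obtain \<alpha> \<beta> \<tau> where p: "u = p + \<alpha> *\<^sub>R (q - p)" "v = p + \<beta> *\<^sub>R (q - p)" "r = p + \<tau> *\<^sub>R (q - p)"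
    using par assms by meson
  obtain \<alpha>' \<beta>' where p': "u = p' + \<alpha>' *\<^sub>R (q' - p')" "v = p' + \<beta>' *\<^sub>R (q' - p')"
    using par assms by meson
  have "\<alpha> \<noteq> \<beta>"
    using p \<open>u \<noteq> v\<close> by auto
  have "v - u = (\<beta> - \<alpha>) *\<^sub>R (q - p)" "r - u = (\<tau> - \<alpha>) *\<^sub>R (q - p)"
    by (simp_all add: p algebra_simps)
  then have "r - u = ((\<tau> - \<alpha>) / (\<beta> - \<alpha>)) *\<^sub>R (v - u)"
    using \<open>\<alpha> \<noteq> \<beta>\<close> by simp
  moreover have "v - u = (\<beta>' - \<alpha>') *\<^sub>R (q' - p')"
    by (simp add: p' algebra_simps)
  ultimately have "r = u + ((\<tau> - \<alpha>) / (\<beta> - \<alpha>)) *\<^sub>R (\<beta>' - \<alpha>') *\<^sub>R (q' - p')"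
    by (metis add_diff_cancel_left' add_diff_eq)
  then obtain \<rho> where r: "r = p' + \<rho> *\<^sub>R (q' - p')"
    using p'(1) by (metis add.assoc scaleR_add_left scaleR_scaleR)
  have "p' - r = (- \<rho>) *\<^sub>R (q' - p')" "q' - r = (1 - \<rho>) *\<^sub>R (q' - p')"
    by (simp_all add: r algebra_simps)
  then have "(p' - r) \<bullet> (q' - r) = - (\<rho> * (1 - \<rho>) * ((q' - p') \<bullet> (q' - p')))"
    by simp
  with neg have "0 < \<rho> * (1 - \<rho>) * ((q' - p') \<bullet> (q' - p'))"
    by simp
  then have "0 < \<rho> * (1 - \<rho>)"
    using inner_ge_zero[of "q' - p'"] by (simp add: zero_less_mult_iff)
  then have "0 \<le> \<rho>" "\<rho> \<le> 1"
    by (auto simp: zero_less_mult_iff)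
  then show ?thesis
    using r by (auto simp: in_segment algebra_simps intro!: exI[of _ \<rho>])
qed

lemma inner_neg_in_closed_segment:
  fixes p q r :: "'a::euclidean_space"
  assumes "r \<in> closed_segment p q" "r \<noteq> p" "r \<noteq> q"
  shows "(p - r) \<bullet> (q - r) < 0"
proof -
  obtain u where u: "0 \<le> u" "u \<le> 1" "r = (1 - u) *\<^sub>R p + u *\<^sub>R q"
    using assms by (auto simp: in_segment)
  then have "p - r = (- u) *\<^sub>R (q - p)" "q - r = (1 - u) *\<^sub>R (q - p)"
    by (simp_all add: algebra_simps)
  moreover from this have "u \<noteq> 0" "u \<noteq> 1" "q \<noteq> p"
    using assms by auto
  ultimately show ?thesis
    using u by (simp add: mult_pos_pos)
qed

text \<open>The reason for the choice of strata. By upper semicontinuity a nearby segment hits no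
  further obstacles. If it hits fewer than two, equal rank leaves no room for a smaller set.
  If it hits two, then it lies on the same line and still contains every obstacle strictly
  between the original endpoints.\<close>

lemma eventually_obstacles_eq:
  assumes "finite Q" "(f \<longlongrightarrow> p) F" "(g \<longlongrightarrow> q) F" "p \<notin> Q" "q \<notin> Q"
  shows "\<forall>\<^sub>F y in F. crossing_rank Q (f y) (g y) = crossing_rank Q p q \<longrightarrow>
           obstacles Q (f y) (g y) = obstacles Q p q"
proof -
  have fin: "finite (obstacles Q p q)"
    using assms(1) by (simp add: obstacles_def)
  have "\<forall>\<^sub>F y in F. (f y - r) \<bullet> (g y - r) < 0" if "r \<in> obstacles Q p q" for r
  proof (rule order_tendstoD(2))
    show "((\<lambda>y. (f y - r) \<bullet> (g y - r)) \<longlongrightarrow> (p - r) \<bullet> (q - r)) F"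
      by (intro tendsto_intros assms)
    show "(p - r) \<bullet> (q - r) < 0"
      using that assms by (intro inner_neg_in_closed_segment) (auto simp: obstacles_def)
  qed
  then have "\<forall>\<^sub>F y in F. \<forall>r\<in>obstacles Q p q. (f y - r) \<bullet> (g y - r) < 0"
    using fin by (intro eventually_ball_finite) auto
  with eventually_obstacles_subset[OF assms(1-3)] show ?thesis
  proof eventually_elim
    case (elim y)
    show ?case
    proof
      assume rank: "crossing_rank Q (f y) (g y) = crossing_rank Q p q"
      show "obstacles Q (f y) (g y) = obstacles Q p q"
      proof (cases "card (obstacles Q (f y) (g y)) < 2")
        case True
        then have "card (obstacles Q (f y) (g y)) = card (obstacles Q p q)"
          using rank by (auto simp: crossing_rank_def min_def split: if_splits)
        then show ?thesis
          using elim(1) fin by (intro card_subset_eq)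
      next
        case False
        then have "\<not> card (obstacles Q (f y) (g y)) \<le> Suc 0"
          by simp
        moreover have "finite (obstacles Q (f y) (g y))"
          using assms(1) by (simp add: obstacles_def)
        ultimately obtain u v where uv: "u \<in> obstacles Q (f y) (g y)" "v \<in> obstacles Q (f y) (g y)" "u \<noteq> v"
          using card_le_Suc0_iff_eq by blast
        have "r \<in> obstacles Q (f y) (g y)" if "r \<in> obstacles Q p q" for r
        proof -
          have "u \<in> closed_segment p q" "v \<in> closed_segment p q" "r \<in> closed_segment p q"
            using uv elim(1) that by (auto simp only: obstacles_def)
          moreover have "u \<in> closed_segment (f y) (g y)" "v \<in> closed_segment (f y) (g y)"
            using uv by (auto simp only: obstacles_def)
          ultimately have "r \<in> closed_segment (f y) (g y)"
            using in_closed_segment_transfer[OF \<open>u \<noteq> v\<close>] elim(2) that by blast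
          then show ?thesis
            using that by (simp add: obstacles_def)
        qed
        then show ?thesis
          using elim(1) by blast
      qed
    qed
  qed
qed

lemma tendsto_clearance:
  assumes "finite Q" "(f \<longlongrightarrow> p) F" "(g \<longlongrightarrow> q) F" "p \<notin> Q" "q \<notin> Q"
    and rank: "\<forall>\<^sub>F y in F. crossing_rank Q (f y) (g y) = crossing_rank Q p q"
  shows "((\<lambda>y. clearance Q (f y) (g y)) \<longlongrightarrow> clearance Q p q) F"
proof (rule Lim_transform_eventually)
  show "((\<lambda>y. \<Prod>r\<in>Q - obstacles Q p q. min 1 (infdist r (closed_segment (f y) (g y))))
          \<longlongrightarrow> clearance Q p q) F"
    unfolding clearance_def
    by (intro tendsto_prod tendsto_min tendsto_const tendsto_infdist_closed_segment assms)
  show "\<forall>\<^sub>F y in F. (\<Prod>r\<in>Q - obstacles Q p q. min 1 (infdist r (closed_segment (f y) (g y))))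
          = clearance Q (f y) (g y)"
    using eventually_obstacles_eq[OF assms(1-5)] rank
    by eventually_elim (simp add: clearance_def)
qed


section \<open>Perpendicular detours\<close>

text \<open>An obstacle on the segment could only be met by returning to the line, which the
  perpendicular bump allows at the endpoints only; the other obstacles are farther away than
  the size of the bump.\<close>

lemma sideways_avoids:
  fixes J :: "'a::euclidean_space \<Rightarrow> 'a"
  assumes perp: "\<And>v. v \<bullet> J v = 0" and J0: "\<And>v. J v = 0 \<Longrightarrow> v = 0"
    and Q: "finite Q" "p \<notin> Q" "q \<notin> Q"
    and t: "t \<in> {0..1}" and \<mu>: "0 < \<mu>" "\<mu> * norm (J (q - p)) < clearance Q p q"
  shows "linepath p q t + (\<mu> * (t * (1 - t))) *\<^sub>R J (q - p) \<notin> Q"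
proof
  let ?w = "(\<mu> * (t * (1 - t))) *\<^sub>R J (q - p)"
  let ?r = "linepath p q t + ?w"
  assume rQ: "?r \<in> Q"
  have r: "?r = p + t *\<^sub>R (q - p) + ?w"
    by (simp add: linepath_def algebra_simps)
  show False
  proof (cases "?r \<in> closed_segment p q")
    case True
    then obtain u where "?r = (1 - u) *\<^sub>R p + u *\<^sub>R q"
      by (auto simp: in_segment)
    then have u: "?r = p + u *\<^sub>R (q - p)"
      by (simp add: algebra_simps)
    have "p + t *\<^sub>R (q - p) + ?w = p + u *\<^sub>R (q - p)"
      by (rule trans[OF r[symmetric] u])
    then have "(u - t) *\<^sub>R (q - p) = ?w"
      by (simp add: algebra_simps)
    then have "((u - t) *\<^sub>R (q - p)) \<bullet> J (q - p) = ?w \<bullet> J (q - p)"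
      by simp
    then have "t = 0 \<or> t = 1 \<or> J (q - p) = 0"
      using perp \<mu> by simp
    then have "t = 0 \<or> t = 1 \<or> p = q"
      using J0 by fastforce
    then have "?r \<in> {p, q}"
      using True by (auto simp: linepath_0' linepath_1')
    then show False
      using rQ Q by auto
  next
    case False
    have "t * (1 - t) \<le> 1"
      using t by (simp add: mult_le_one)
    have "clearance Q p q \<le> infdist ?r (closed_segment p q)"
      using False rQ Q by (intro clearance_le) auto
    also have "\<dots> \<le> dist ?r (linepath p q t)"
      using t by (intro infdist_le linepath_in_path) auto
    also have "\<dots> = (t * (1 - t)) * (\<mu> * norm (J (q - p)))"
      using t \<mu> by (simp add: dist_norm abs_mult)
    also have "\<dots> \<le> 1 * (\<mu> * norm (J (q - p)))"
      using \<mu> \<open>t * (1 - t) \<le> 1\<close> by (intro mult_right_mono) auto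
    finally show False
      using \<mu> by simp
  qed
qed

text \<open>The coordinates are paired up, and \<open>J\<close> rotates each coordinate plane of a pair by a right
  angle. The involution \<open>\<sigma>\<close> swaps the members of a pair, and the sign \<open>e\<close> distinguishes them.\<close>

lemma perpendicular_map_exists:
  assumes "even CARD('n::finite)"
  obtains J :: "real ^ 'n \<Rightarrow> real ^ 'n"
  where "linear J" "\<And>v. v \<bullet> J v = 0" "\<And>v. J v = 0 \<Longrightarrow> v = 0"
proof -
  obtain m where m: "CARD('n) = 2 * m"
    using assms by blast
  then obtain A :: "'n set" where A: "card A = m"
    using obtain_subset_with_card_n[of m "UNIV :: 'n set"] by auto
  have "card (- A) = card A"
    using m A by (simp add: Compl_eq_Diff_UNIV card_Diff_subset)
  then obtain h where h: "bij_betw h A (- A)"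
    using finite_same_card_bij[of A "- A"] by auto
  define \<sigma> where "\<sigma> i = (if i \<in> A then h i else inv_into A h i)" for i
  define e :: "'n \<Rightarrow> real" where "e i = (if i \<in> A then - 1 else 1)" for i
  have hA: "h i \<notin> A" if "i \<in> A" for i
    using h that by (auto dest: bij_betwE)
  have hB: "inv_into A h i \<in> A" "h (inv_into A h i) = i" if "i \<notin> A" for i
    using h that bij_betw_inv_into_right[OF h, of i] bij_betwE[OF bij_betw_inv_into[OF h]] by auto
  have \<sigma>\<sigma>: "\<sigma> (\<sigma> i) = i" for i
    using hA hB bij_betw_inv_into_left[OF h] by (auto simp: \<sigma>_def)
  have e\<sigma>: "e (\<sigma> i) = - e i" for i
    using hA hB by (auto simp: \<sigma>_def e_def)
  have bij: "bij \<sigma>"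
    using \<sigma>\<sigma> by (rule involuntory_imp_bij)
  define J :: "real ^ 'n \<Rightarrow> real ^ 'n" where "J v = (\<chi> i. e i * v $ \<sigma> i)" for v
  show thesis
  proof
    show "linear J"
      by (rule linearI) (auto simp: J_def vec_eq_iff algebra_simps)
    show "v \<bullet> J v = 0" for v
    proof -
      \<comment> \<open>Reindexing by \<open>\<sigma>\<close> changes the sign of the sum, so it vanishes.\<close>
      have "v \<bullet> J v = (\<Sum>i\<in>UNIV. v $ i * (e i * v $ \<sigma> i))"
        by (simp add: inner_vec_def J_def)
      also have "\<dots> = (\<Sum>i\<in>UNIV. v $ \<sigma> i * (e (\<sigma> i) * v $ \<sigma> (\<sigma> i)))"
        by (rule sum.reindex_bij_betw[OF bij, symmetric])
      also have "\<dots> = - (\<Sum>i\<in>UNIV. v $ i * (e i * v $ \<sigma> i))"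
        by (simp add: \<sigma>\<sigma> e\<sigma> sum_negf mult_ac)
      also have "\<dots> = - (v \<bullet> J v)"
        by (simp add: inner_vec_def J_def)
      finally show ?thesis by simp
    qed
    show "v = 0" if "J v = 0" for v
    proof -
      have "v $ \<sigma> i = 0" for i
        using that[THEN arg_cong, of "\<lambda>w. w $ i"] by (auto simp: J_def e_def split: if_splits)
      then show ?thesis
        by (metis \<sigma>\<sigma> vec_eq_iff zero_index)
    qed
  qed
qed


section \<open>Strata and motion planning rules\<close>

text \<open>The three summands count the obstacles met by the first point, those met by the second
  point, and the collisions between the two points.\<close>

definition total_rank :: "'a::euclidean_space set \<Rightarrow> ('a \<times> 'a) \<times> ('a \<times> 'a) \<Rightarrow> nat" where
  "total_rank Q = (\<lambda>((a, b), (a', b')).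
     crossing_rank Q a a' + crossing_rank Q b b' + crossing_rank {0} (b - a) (b' - a'))"

text \<open>The clearances are at most 1, so their product is bounded by each of them; the
  denominator exceeds the norm of \<open>J\<close> applied to the direction of each of the three segments.\<close>

definition detour_size ::
    "('a::euclidean_space \<Rightarrow> 'a) \<Rightarrow> 'a set \<Rightarrow> ('a \<times> 'a) \<times> ('a \<times> 'a) \<Rightarrow> real" where
  "detour_size J Q = (\<lambda>((a, b), (a', b')).
     clearance Q a a' * clearance Q b b' * clearance {0} (b - a) (b' - a')
     / (1 + norm (J (a' - a)) + norm (J (b' - b))))"

definition detour ::
    "('a::euclidean_space \<Rightarrow> 'a) \<Rightarrow> 'a set \<Rightarrow> ('a \<times> 'a) \<times> ('a \<times> 'a) \<Rightarrow> real \<Rightarrow> real \<Rightarrow> 'a \<times> 'a" where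
  "detour J Q x s t = linepath (fst x) (snd x) t +
     (s * detour_size J Q x * (t * (1 - t))) *\<^sub>R map_prod J J (snd x - fst x)"

lemma total_rank_le_5: "total_rank Q x \<le> 5"
proof -
  have "crossing_rank R p q \<le> 2" for R and p q :: 'a
    by (simp add: crossing_rank_def)
  moreover have "crossing_rank {0} p q \<le> 1" for p q :: 'a
    using card_mono[of "{0}" "obstacles {0} p q"] by (auto simp: crossing_rank_def obstacles_def)
  ultimately have "total_rank Q x \<le> (2 + 2) + 1"
    unfolding total_rank_def case_prod_unfold by (intro add_mono)
  then show ?thesis by simp
qed

lemma eventually_rank_le:
  assumes "finite Q" "((\<lambda>y. y) \<longlongrightarrow> ((a, b), (a', b'))) F"
  shows "\<forall>\<^sub>F y in F.
     crossing_rank Q (fst (fst y)) (fst (snd y)) \<le> crossing_rank Q a a' \<and>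
     crossing_rank Q (snd (fst y)) (snd (snd y)) \<le> crossing_rank Q b b' \<and>
     crossing_rank {0} (snd (fst y) - fst (fst y)) (snd (snd y) - fst (snd y))
       \<le> crossing_rank {0} (b - a) (b' - a')"
proof -
  have *: "((\<lambda>y. fst (fst y)) \<longlongrightarrow> a) F" "((\<lambda>y. snd (fst y)) \<longlongrightarrow> b) F"
     "((\<lambda>y. fst (snd y)) \<longlongrightarrow> a') F" "((\<lambda>y. snd (snd y)) \<longlongrightarrow> b') F"
    using assms(2)[THEN tendsto_fst, THEN tendsto_fst] assms(2)[THEN tendsto_fst, THEN tendsto_snd]
      assms(2)[THEN tendsto_snd, THEN tendsto_fst] assms(2)[THEN tendsto_snd, THEN tendsto_snd]
    by simp_all
  show ?thesis
    by (intro eventually_conj eventually_crossing_rank_le assms * tendsto_diff) simp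
qed

lemma open_total_rank_less:
  assumes "finite Q"
  shows "open {x. total_rank Q x < k}"
proof -
  have "\<forall>\<^sub>F y in nhds x. y \<in> {x. total_rank Q x < k}" if "total_rank Q x < k" for x
  proof -
    obtain a b a' b' where x: "x = ((a, b), (a', b'))"
      by (metis prod.exhaust)
    have "((\<lambda>y. y) \<longlongrightarrow> ((a, b), (a', b'))) (nhds x)"
      by (simp add: x filterlim_ident)
    from eventually_rank_le[OF assms this] show ?thesis
    proof eventually_elim
      case (elim y)
      then have "total_rank Q y \<le> total_rank Q x"
        by (auto simp: total_rank_def x case_prod_unfold)
      with that show ?case by simp
    qed
  qed
  then have "\<exists>S. open S \<and> x \<in> S \<and> S \<subseteq> {x. total_rank Q x < k}" if "total_rank Q x < k" for x
    using that unfolding eventually_nhds subset_eq by simp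
  then show ?thesis
    by (subst open_subopen) simp
qed

text \<open>Continuity holds only within a level set of the total rank: it rests on the obstacle
  sets of all three segments being locally constant there.\<close>

lemma continuous_on_detour_size:
  assumes J: "linear J" and Q: "finite Q"
    and E: "\<And>x. x \<in> E \<Longrightarrow> x \<in> config2 (UNIV - Q) \<times> config2 (UNIV - Q) \<and> total_rank Q x = k"
  shows "continuous_on E (detour_size J Q)"
  unfolding continuous_on_def
proof
  fix x assume "x \<in> E"
  obtain a b a' b' where x: "x = ((a, b), (a', b'))"
    by (metis prod.exhaust)
  define F where "F = at x within E"
  have id: "((\<lambda>y. y) \<longlongrightarrow> ((a, b), (a', b'))) F"
    unfolding F_def x by (rule tendsto_ident_at)
  have *: "((\<lambda>y. fst (fst y)) \<longlongrightarrow> a) F" "((\<lambda>y. snd (fst y)) \<longlongrightarrow> b) F"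
     "((\<lambda>y. fst (snd y)) \<longlongrightarrow> a') F" "((\<lambda>y. snd (snd y)) \<longlongrightarrow> b') F"
    using id[THEN tendsto_fst, THEN tendsto_fst] id[THEN tendsto_fst, THEN tendsto_snd]
      id[THEN tendsto_snd, THEN tendsto_fst] id[THEN tendsto_snd, THEN tendsto_snd]
    by simp_all
  have inX: "a \<notin> Q" "b \<notin> Q" "a' \<notin> Q" "b' \<notin> Q" "b - a \<notin> {0}" "b' - a' \<notin> {0}"
    using E[OF \<open>x \<in> E\<close>] by (auto simp: x config2_def)
  have "\<forall>\<^sub>F y in F. y \<in> E"
    unfolding F_def by (auto simp: eventually_at_filter)
  \<comment> \<open>Near \<open>x\<close> none of the three ranks can grow, and on \<open>E\<close> their sum is constant, so each is
    constant.\<close>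
  then have ranks: "\<forall>\<^sub>F y in F.
     crossing_rank Q (fst (fst y)) (fst (snd y)) = crossing_rank Q a a' \<and>
     crossing_rank Q (snd (fst y)) (snd (snd y)) = crossing_rank Q b b' \<and>
     crossing_rank {0} (snd (fst y) - fst (fst y)) (snd (snd y) - fst (snd y))
       = crossing_rank {0} (b - a) (b' - a')"
    using eventually_rank_le[OF Q id]
  proof eventually_elim
    case (elim y)
    then have "total_rank Q y = total_rank Q x"
      using E \<open>x \<in> E\<close> by simp
    with elim(2) show ?case
      unfolding total_rank_def x case_prod_unfold by simp
  qed
  have cl: "((\<lambda>y. clearance Q (fst (fst y)) (fst (snd y))) \<longlongrightarrow> clearance Q a a') F"
     "((\<lambda>y. clearance Q (snd (fst y)) (snd (snd y))) \<longlongrightarrow> clearance Q b b') F"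
     "((\<lambda>y. clearance {0} (snd (fst y) - fst (fst y)) (snd (snd y) - fst (snd y)))
        \<longlongrightarrow> clearance {0} (b - a) (b' - a')) F"
    using ranks by (auto intro!: tendsto_clearance tendsto_diff Q * inX elim: eventually_mono)
  have Jlim: "((\<lambda>y. J (f y)) \<longlongrightarrow> J v) F" if "(f \<longlongrightarrow> v) F" for f v
    using J that by (simp add: linear_conv_bounded_linear bounded_linear.tendsto)
  have "1 + norm (J (a' - a)) + norm (J (b' - b)) \<noteq> 0"
    by (smt (verit) norm_ge_zero)
  then show "(detour_size J Q \<longlongrightarrow> detour_size J Q x) (at x within E)"
    unfolding F_def[symmetric] unfolding detour_size_def x case_prod_unfold
    by (auto intro!: tendsto_intros cl Jlim *)
qed

lemma detour_size_pos: "0 < detour_size J Q x"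
  unfolding detour_size_def
  by (auto simp: clearance_pos split: prod.split intro!: divide_pos_pos mult_pos_pos add_pos_nonneg)

lemma detour_in_config2:
  fixes J :: "'a::euclidean_space \<Rightarrow> 'a"
  assumes J: "linear J" and perp: "\<And>v. v \<bullet> J v = 0" and J0: "\<And>v. J v = 0 \<Longrightarrow> v = 0"
    and Q: "finite Q" and x: "x \<in> config2 (UNIV - Q) \<times> config2 (UNIV - Q)"
    and s: "0 < s" "s \<le> 1" and t: "t \<in> {0..1}"
  shows "detour J Q x s t \<in> config2 (UNIV - Q)"
proof -
  obtain a b a' b' where x_eq: "x = ((a, b), (a', b'))"
    by (metis prod.exhaust)
  have inX: "a \<notin> Q" "b \<notin> Q" "a' \<notin> Q" "b' \<notin> Q" "b - a \<notin> {0}" "b' - a' \<notin> {0}"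
    using x by (auto simp: x_eq config2_def)
  define \<mu> where "\<mu> = s * detour_size J Q x"
  let ?c1 = "clearance Q a a'" and ?c2 = "clearance Q b b'" and ?c3 = "clearance {0} (b - a) (b' - a')"
  let ?N = "1 + norm (J (a' - a)) + norm (J (b' - b))"
  have \<mu>: "0 < \<mu>"
    using s by (simp add: \<mu>_def detour_size_pos)
  have N: "0 < ?N"
    by (intro add_pos_nonneg) auto
  have "\<mu> * ?N \<le> detour_size J Q x * ?N"
    using s N detour_size_pos[of J Q x] by (simp add: \<mu>_def mult_le_cancel_right)
  also have "\<dots> = ?c1 * ?c2 * ?c3"
    using N by (simp add: detour_size_def x_eq)
  finally have le: "\<mu> * ?N \<le> ?c1 * ?c2 * ?c3" .
  \<comment> \<open>One estimate serves all three segments; \<open>y\<close> stands for the norm of \<open>J\<close> of a direction.\<close>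
  have small: "\<mu> * y < c" if "y \<le> norm (J (a' - a)) + norm (J (b' - b))" "c \<in> {?c1, ?c2, ?c3}" for y c
  proof -
    have "?c1 * ?c2 * ?c3 \<le> c"
      using that(2) clearance_le_1[of Q a a'] clearance_le_1[of Q b b'] clearance_le_1[of "{0}" "b - a" "b' - a'"]
        clearance_pos[of Q a a'] clearance_pos[of Q b b'] clearance_pos[of "{0}" "b - a" "b' - a'"]
      by (elim insertE emptyE) (simp_all add: mult_le_one mult_left_le mult_le_cancel_left2 mult.assoc)
    moreover have "\<mu> * y < \<mu> * ?N"
      using that(1) \<mu> by simp
    ultimately show ?thesis
      using le by linarith
  qed
  have J_diff: "J ((b' - a') - (b - a)) = J (b' - b) - J (a' - a)"
    using J by (simp add: linear_diff[symmetric] algebra_simps)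
  have "linepath a a' t + (\<mu> * (t * (1 - t))) *\<^sub>R J (a' - a) \<notin> Q"
    by (rule sideways_avoids[OF perp J0 Q inX(1) inX(3) t \<mu>]) (assumption, rule small, simp_all)
  moreover have "linepath b b' t + (\<mu> * (t * (1 - t))) *\<^sub>R J (b' - b) \<notin> Q"
    by (rule sideways_avoids[OF perp J0 Q inX(2) inX(4) t \<mu>]) (assumption, rule small, simp_all)
  \<comment> \<open>Avoiding collisions means keeping the difference of the two points away from \<open>0\<close>.\<close>
  moreover have "linepath (b - a) (b' - a') t + (\<mu> * (t * (1 - t))) *\<^sub>R J ((b' - a') - (b - a)) \<notin> {0}"
  proof (rule sideways_avoids[OF perp J0])
    show "\<mu> * norm (J ((b' - a') - (b - a))) < ?c3"
      using norm_triangle_ineq4[of "J (b' - b)" "J (a' - a)"] unfolding J_diff by (auto intro!: small)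
  qed (use inX t \<mu> in auto)
  moreover have "linepath (b - a) (b' - a') t + (\<mu> * (t * (1 - t))) *\<^sub>R J ((b' - a') - (b - a)) =
     (linepath b b' t + (\<mu> * (t * (1 - t))) *\<^sub>R J (b' - b)) -
     (linepath a a' t + (\<mu> * (t * (1 - t))) *\<^sub>R J (a' - a))"
    unfolding J_diff by (simp add: linepath_def algebra_simps)
  moreover have "detour J Q x s t = (linepath a a' t + (\<mu> * (t * (1 - t))) *\<^sub>R J (a' - a),
     linepath b b' t + (\<mu> * (t * (1 - t))) *\<^sub>R J (b' - b))"
    by (simp add: detour_def x_eq \<mu>_def linepath_def)
  ultimately show ?thesis
    by (auto simp: config2_def)
qed

lemma dist_detour_le:
  assumes "0 \<le> s" "t \<in> {0..1}" "t' \<in> {0..1}"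
  shows "dist (detour J Q x s t) (detour J Q x s t') \<le>
     (dist (fst x) (snd x) + s * (detour_size J Q x * norm (map_prod J J (snd x - fst x)))) * \<bar>t - t'\<bar>"
proof -
  let ?v = "snd x - fst x"
  let ?w = "map_prod J J ?v"
  define c where "c = s * detour_size J Q x"
  have c: "0 \<le> c"
    using assms detour_size_pos[of J Q x] by (simp add: c_def)
  \<comment> \<open>The profile \<open>t (1 - t)\<close> is 1-Lipschitz on the unit interval.\<close>
  have "\<bar>1 - t - t'\<bar> \<le> 1"
    using assms by auto
  then have "\<bar>t - t'\<bar> * \<bar>1 - t - t'\<bar> \<le> \<bar>t - t'\<bar>"
    by (simp add: mult_left_le)
  moreover have "t * (1 - t) - t' * (1 - t') = (t - t') * (1 - t - t')"
    by (simp add: algebra_simps)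
  ultimately have q: "\<bar>t * (1 - t) - t' * (1 - t')\<bar> \<le> \<bar>t - t'\<bar>"
    by (simp add: abs_mult)
  have "detour J Q x s t - detour J Q x s t' =
     (t - t') *\<^sub>R ?v + (c * (t * (1 - t) - t' * (1 - t'))) *\<^sub>R ?w"
    by (simp add: detour_def c_def[symmetric] linepath_def algebra_simps)
  then have "dist (detour J Q x s t) (detour J Q x s t') \<le>
      \<bar>t - t'\<bar> * norm ?v + c * \<bar>t * (1 - t) - t' * (1 - t')\<bar> * norm ?w"
    using norm_triangle_ineq[of "(t - t') *\<^sub>R ?v" "(c * (t * (1 - t) - t' * (1 - t'))) *\<^sub>R ?w"] c
    by (simp add: dist_norm abs_mult)
  also have "\<dots> \<le> \<bar>t - t'\<bar> * norm ?v + c * \<bar>t - t'\<bar> * norm ?w"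
    using q c by (intro add_left_mono mult_right_mono mult_left_mono) auto
  also have "\<dots> = (dist (fst x) (snd x) + s * (detour_size J Q x * norm ?w)) * \<bar>t - t'\<bar>"
    by (simp add: c_def dist_norm norm_minus_commute algebra_simps)
  finally show ?thesis .
qed

lemma detour_endpoints [simp]: "detour J Q x s 0 = fst x" "detour J Q x s 1 = snd x"
  by (simp_all add: detour_def linepath_0' linepath_1')

lemma curve_length_restrict: "curve_length (restrict \<gamma> {0..1}) = curve_length \<gamma>"
  unfolding curve_length_def
  by (rule SUP_cong) (auto simp: image_subset_iff intro!: arg_cong[where f = ennreal] sum.cong)

text \<open>The length is squeezed between the distance of the endpoints and the Lipschitz
  constant of the detour.\<close>

lemma curve_length_detour_tendsto:
  assumes s: "\<And>n. s n \<in> {0..1}" "s \<longlonglongrightarrow> 0"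
  shows "(\<lambda>n. curve_length (detour J Q x (s n))) \<longlonglongrightarrow> curve_length (detour J Q x 0)"
proof -
  let ?d = "dist (fst x) (snd x)"
  let ?C = "detour_size J Q x * norm (map_prod J J (snd x - fst x))"
  have lower: "ennreal ?d \<le> curve_length (detour J Q x r)" for r
    using dist_endpoints_le_curve_length[of "detour J Q x r"] by simp
  have upper: "curve_length (detour J Q x r) \<le> ennreal (?d + r * ?C)" if "0 \<le> r" for r
    using that by (intro curve_length_le_Lipschitz dist_detour_le)
  have "curve_length (detour J Q x 0) = ennreal ?d"
    using lower[of 0] upper[of 0] by (simp add: order_antisym)
  moreover have "(\<lambda>n. curve_length (detour J Q x (s n))) \<longlonglongrightarrow> ennreal ?d"
  proof (rule tendsto_sandwich[OF _ _ tendsto_const])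
    have "(\<lambda>n. ?d + s n * ?C) \<longlonglongrightarrow> ?d + 0 * ?C"
      by (intro tendsto_intros s)
    then show "(\<lambda>n. ennreal (?d + s n * ?C)) \<longlonglongrightarrow> ennreal ?d"
      by (intro tendsto_ennrealI) simp
  qed (use lower upper s(1) in auto)
  ultimately show ?thesis by simp
qed

text \<open>This is equality in the triangle inequality, so straight paths are the only geodesics
  in Euclidean space.\<close>

lemma linepath_unique:
  fixes p q y :: "'a::euclidean_space"
  assumes t: "t \<in> {0..1}" and py: "dist p y = t * dist p q" and yq: "dist y q = (1 - t) * dist p q"
  shows "y = linepath p q t"
proof (cases "p = q")
  case True
  then show ?thesis
    using py by (simp add: linepath_def algebra_simps)
next
  case False
  have "dist p q = dist p y + dist y q"
    using py yq by (simp add: algebra_simps)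
  then have "dist p y *\<^sub>R (y - q) = dist y q *\<^sub>R (p - y)"
    unfolding dist_norm[of p y] dist_norm[of y q] by (simp only: dist_triangle_eq flip: dist_norm)
  then have "(t * dist p q) *\<^sub>R (y - q) = ((1 - t) * dist p q) *\<^sub>R (p - y)"
    by (simp only: py yq)
  then have "dist p q *\<^sub>R (t *\<^sub>R (y - q)) = dist p q *\<^sub>R ((1 - t) *\<^sub>R (p - y))"
    by (simp add: mult.commute)
  then have "t *\<^sub>R (y - q) = (1 - t) *\<^sub>R (p - y)"
    using False by (metis scaleR_cancel_left dist_eq_0_iff)
  then show ?thesis
    by (simp add: linepath_def algebra_simps)
qed

text \<open>The rule follows the detours. A geodesic inside the configuration space is straight by
  \<open>linepath_unique\<close>, so it coincides with the detour at parameter 0, as the proviso on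
  geodesics requires.\<close>

lemma NGMPR_stratum:
  fixes J :: "'a::euclidean_space \<Rightarrow> 'a" and Q :: "'a set"
  assumes J: "linear J" and perp: "\<And>v. v \<bullet> J v = 0" and J0: "\<And>v. J v = 0 \<Longrightarrow> v = 0"
    and Q: "finite Q"
    and E: "\<And>x. x \<in> E \<Longrightarrow> x \<in> config2 (UNIV - Q) \<times> config2 (UNIV - Q) \<and> total_rank Q x = k"
  shows "\<exists>\<Phi>. NGMPR (config2 (UNIV - Q)) E \<Phi>"
proof -
  let ?X = "config2 (UNIV - Q)"
  define \<Phi> where "\<Phi> = (\<lambda>x. restrict (\<lambda>s. restrict (detour J Q x s) {0..1}) {0..1::real})"
  have \<Phi>_eq: "\<Phi> x s = restrict (detour J Q x s) {0..1}" if "s \<in> {0..1}" for x s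
    using that by (simp add: \<Phi>_def)
  have cl: "closure ?X = UNIV"
    using Q by (rule closure_config2)
  have JJ: "map_prod J J z = (J (fst z), J (snd z))" for z
    by (simp add: map_prod_def case_prod_unfold)
  have size: "continuous_on ((E \<times> {0..1::real}) \<times> {0..1::real}) (\<lambda>y. detour_size J Q (fst (fst y)))"
    by (rule continuous_on_compose2[OF continuous_on_detour_size[OF J Q E]])
       (auto intro!: continuous_intros)
  have contJ: "continuous_on S (\<lambda>y. J (f y))" if "continuous_on S f"
    for S :: "(((('a \<times> 'a) \<times> 'a \<times> 'a) \<times> real) \<times> real) set" and f
    using J that by (simp add: linear_conv_bounded_linear bounded_linear.continuous_on)
  have "continuous_on ((E \<times> {0..1}) \<times> {0..1}) (\<lambda>((x, s), t). detour J Q x s t)"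
    unfolding case_prod_unfold detour_def linepath_def JJ
    by (intro continuous_intros contJ size)
  then have cont: "continuous_map (top_of_set E) (path_space (path_space euclidean)) \<Phi>"
    unfolding \<Phi>_def by (rule continuous_map_curry_path_space)
  have near: "near_geodesic ?X (fst x) (snd x) (\<Phi> x)"
    and geod: "is_geodesic ?X (fst x) (snd x) \<gamma> \<Longrightarrow> is_geodesic ?X (fst x) (snd x) (\<Phi> x 0)"
    if xE: "x \<in> E" for x \<gamma>
  proof -
    have "\<Phi> x \<in> topspace (path_space (path_space euclidean))"
      by (rule funcset_mem[OF continuous_map_funspace[OF cont]]) (simp add: xE)
    then have cx: "continuous_map (top_of_set {0..1}) (path_space euclidean) (\<Phi> x)"
      by (simp add: path_space_def topspace_compact_open_topology)
    have paths: "\<Phi> x s \<in> paths_between UNIV (fst x) (snd x)" if s: "s \<in> {0..1}" for s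
    proof -
      have "\<Phi> x s \<in> topspace (path_space euclidean)"
        by (rule funcset_mem[OF continuous_map_funspace[OF cx]]) (use s in simp)
      then show ?thesis
        by (simp add: paths_between_def \<Phi>_eq[OF s])
    qed
    have into: "\<Phi> x s \<in> paths_between S (fst x) (snd x)"
      if "s \<in> {0..1}" "\<And>t. t \<in> {0..1} \<Longrightarrow> \<Phi> x s t \<in> S" for s S
      using paths[OF that(1)] that(2)
      by (auto simp: paths_between_def path_space_def topspace_compact_open_topology)
    have straight: "dist (\<Phi> x 0 t) (\<Phi> x 0 t') = \<bar>t - t'\<bar> * dist (fst x) (snd x)"
      if "t \<in> {0..1}" "t' \<in> {0..1}" for t t'
    proof -
      have "linepath (fst x) (snd x) t - linepath (fst x) (snd x) t' = (t' - t) *\<^sub>R (fst x - snd x)"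
        by (simp add: linepath_def algebra_simps)
      then show ?thesis
        using that by (simp add: \<Phi>_eq detour_def dist_norm abs_minus_commute)
    qed
    show "near_geodesic ?X (fst x) (snd x) (\<Phi> x)"
      unfolding near_geodesic_def cl
    proof (intro conjI ballI allI impI)
      show "continuous_map (top_of_set {0..1})
         (subtopology (path_space (top_of_set UNIV)) (paths_between UNIV (fst x) (snd x))) (\<Phi> x)"
        unfolding subtopology_UNIV continuous_map_in_subtopology using cx paths by auto
      show "is_geodesic UNIV (fst x) (snd x) (\<Phi> x 0)"
        unfolding is_geodesic_def using straight paths[of 0] by simp
      show "\<Phi> x s \<in> paths_between ?X (fst x) (snd x)" if s: "s \<in> {0<..1}" for s
      proof (rule into)
        show "s \<in> {0..1}"
          using s by simp
        show "\<Phi> x s t \<in> ?X" if "t \<in> {0..1}" for t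
          using s that detour_in_config2[OF J perp J0 Q, of x s t] E[OF xE] by (simp add: \<Phi>_eq)
      qed
      show "(\<lambda>n. curve_length (\<Phi> x (s n))) \<longlonglongrightarrow> curve_length (\<Phi> x 0)"
        if s: "(\<forall>n. s n \<in> {0..1}) \<and> s \<longlonglongrightarrow> 0" for s
      proof -
        have "\<Phi> x (s n) = restrict (detour J Q x (s n)) {0..1}" for n
          using s by (intro \<Phi>_eq) auto
        moreover have "\<Phi> x 0 = restrict (detour J Q x 0) {0..1}"
          by (intro \<Phi>_eq) auto
        ultimately show ?thesis
          using s by (simp only: curve_length_restrict curve_length_detour_tendsto)
      qed
    qed
    show "is_geodesic ?X (fst x) (snd x) (\<Phi> x 0)" if \<gamma>: "is_geodesic ?X (fst x) (snd x) \<gamma>"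
    proof -
      have ends: "\<gamma> 0 = fst x" "\<gamma> 1 = snd x" and \<gamma>X: "\<And>t. t \<in> {0..1} \<Longrightarrow> \<gamma> t \<in> ?X"
        using \<gamma> by (auto simp: is_geodesic_def paths_between_def path_space_def
            topspace_compact_open_topology)
      have d: "dist (\<gamma> t) (\<gamma> t') = \<bar>t - t'\<bar> * dist (fst x) (snd x)"
        if "t \<in> {0..1}" "t' \<in> {0..1}" for t t'
        using \<gamma> that by (simp only: is_geodesic_def)
      have "\<Phi> x 0 t \<in> ?X" if t: "t \<in> {0..1}" for t
      proof -
        have "\<gamma> t = linepath (fst x) (snd x) t"
          using t d[of 0 t] d[of t 1] by (intro linepath_unique) (auto simp: ends)
        then show ?thesis
          using t \<gamma>X[OF t] by (simp add: \<Phi>_eq detour_def)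
      qed
      then show ?thesis
        unfolding is_geodesic_def using straight into[of 0] by simp
    qed
  qed
  have "NGMPR ?X E \<Phi>"
    unfolding NGMPR_def cl subtopology_UNIV case_prod_unfold
  proof (intro conjI ballI impI)
    fix x assume "x \<in> E"
    then show "near_geodesic ?X (fst x) (snd x) (\<Phi> (fst x, snd x))"
      using near by simp
    assume "\<exists>\<gamma>. is_geodesic ?X (fst x) (snd x) \<gamma>"
    then show "is_geodesic ?X (fst x) (snd x) (\<Phi> (fst x, snd x) 0)"
      using geod[OF \<open>x \<in> E\<close>] by (auto simp only: prod.collapse)
  qed (rule cont)
  then show ?thesis
    by blast
qed

theorem theorem3p1:
  fixes Q :: "(real ^ 'n) set"
  assumes "even CARD('n)"
    and "finite Q"
    and "card Q \<ge> 2"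
  shows "geodesic_complexity (config2 (UNIV - Q)) \<le> 5"
proof -
  let ?X = "config2 (UNIV - Q)"
  obtain J :: "real ^ 'n \<Rightarrow> real ^ 'n"
    where J: "linear J" "\<And>v. v \<bullet> J v = 0" "\<And>v. J v = 0 \<Longrightarrow> v = 0"
    using perpendicular_map_exists[OF assms(1)] by blast
  define E where "E k = {x \<in> ?X \<times> ?X. total_rank Q x = k}" for k
  have "open ?X"
  proof -
    have "open ((- Q) \<times> (- Q))"
      using assms(2) by (intro open_Times) (auto simp: finite_imp_closed open_Compl)
    moreover have "open {z :: (real ^ 'n) \<times> (real ^ 'n). fst z \<noteq> snd z}"
      by (intro open_Collect_neq continuous_intros)
    moreover have "?X = ((- Q) \<times> (- Q)) \<inter> {z. fst z \<noteq> snd z}"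
      by (auto simp: config2_def)
    ultimately show ?thesis by auto
  qed
  have "locally compact (E k)" for k
  proof -
    \<comment> \<open>Level sets of an upper semicontinuous integer function are locally closed.\<close>
    have "E k = - {x. total_rank Q x < k} \<inter> (?X \<times> ?X \<inter> {x. total_rank Q x < Suc k})"
      by (auto simp: E_def)
    moreover have "closed (- {x. total_rank Q x < k})"
      using open_total_rank_less[OF assms(2)] by (simp add: closed_Compl)
    moreover have "open (?X \<times> ?X \<inter> {x. total_rank Q x < Suc k})"
      using \<open>open ?X\<close> open_total_rank_less[OF assms(2)] by (intro open_Int open_Times)
    ultimately show ?thesis
      unfolding locally_compact_closed_Int_open by blast
  qed
  moreover have "\<exists>\<Phi>. NGMPR ?X (E k) \<Phi>" for k
    by (rule NGMPR_stratum[OF J assms(2)]) (auto simp: E_def)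
  moreover have "(\<Union>i\<le>5. E i) = ?X \<times> ?X"
    using total_rank_le_5 by (auto simp: E_def)
  moreover have "disjoint_family_on E {..5}"
    by (auto simp: disjoint_family_on_def E_def)
  ultimately have "geodesic_complexity ?X \<le> enat 5"
    unfolding geodesic_complexity_def by (intro Inf_lower) blast
  then show ?thesis
    by (simp add: numeral_eq_enat)
qed

end
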